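(* Let $\phi\colon \mathbb{F}_q[T]\to \mathrm{End}_{\mathbb{F}_q(T)}(\mathbb{G}_a)$ be a Drinfeld module of rank $2$ given by $$\phi_T(x)=Tx+gx^q+\Delta x^{q^2},$$ where $g,\Delta\in\mathbb{F}_q[T]$ (with $\Delta\neq 0$). Let $N$ be the least common multiple of the degrees of the irreducible divisors of $\Delta$. Suppose that $\phi_T(1)=T+g+\Delta$ is coprime to $T\Delta$ in $\mathbb{F}_q[T]$. Let $S$ be the finite set of places $\{v\in M_{\mathbb{F}_q(T)} : v\mid T\Delta\}\cup\{v_\infty\}$. If $x\in\mathbb{F}_q[T]$ is not a torsion point of $\phi$, then $$\max \mathcal{Z}(\phi,x)\le \left(6(q^{2N}-1)N|S|+4\right)+\frac12\log_q\left(2+2\deg g+2\deg\Delta\right).$$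
   Context: $q$ is a power of a prime $p$. $M_{\mathbb{F}_q(T)}$ is the set of places of $\mathbb{F}_q(T)$: the finite places, corresponding to monic irreducible polynomials $P\in\mathbb{F}_q[T]$, and the infinite place $v_\infty$; "$v\mid T\Delta$" means $v$ is a finite place whose irreducible polynomial divides $T\Delta$. A Drinfeld module $\phi$ of rank $2$ is the $\mathbb{F}_q$-algebra homomorphism determined by $\phi_T$ as given, acting on the additive group by $\mathbb{F}_q$-linear polynomials; $\phi_{T^n}$ is the $n$-fold composition of $\phi_T$ (with $\phi_{T^0}(x)=x$). A point $x$ is a torsion point of $\phi$ if $\phi_a(x)=0$ for some nonzero $a\in\mathbb{F}_q[T]$. For $n\ge 0$ write $\phi_{T^n}(x)=\mathfrak{A}_n\mathfrak{B}_n^{-1}$ with $\mathfrak{A}_n,\mathfrak{B}_n\in\mathbb{F}_q[T]$ coprime. A primitive divisor of $\mathfrak{A}_n$ is a prime $\mathfrak{p}$ of $\mathbb{F}_q[T]$ with $\mathfrak{p}\mid\mathfrak{A}_n$ and $\mathfrak{p}\nmid\mathfrak{A}_i$ for all $0\le i<n$. The Zsigmondy set is $\mathcal{Z}(\phi,x)=\{n\ge1:\mathfrak{A}_n\text{ has no primitive divisor}\}$. $\log_q$ denotes logarithm to base $q$. *)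

theory Defs
  imports
    "HOL-Computational_Algebra.Computational_Algebra"
    "HOL-Library.Cardinality"
    Complex_Main
begin

section \<open>Places of the rational function field\<close>

text \<open>
  The base field with \<open>q\<close> elements is a type of class \<open>finite_field\<close>, so \<open>q = CARD('a)\<close>;
  the polynomial ring is \<open>'a poly\<close>, and its fraction field is \<open>'a poly fract\<close>.
\<close>

abbreviation polyT :: "'a :: field poly"
  where "polyT \<equiv> [:0, 1:]"

datatype 'p place = Finite_Place 'p | Infinite_Place

definition places :: "'a :: field poly place set"
  where "places = Finite_Place ` {P. irreducible P \<and> lead_coeff P = 1} \<union> {Infinite_Place}"

definition place_dvd :: "'a :: field poly place \<Rightarrow> 'a poly \<Rightarrow> bool"
  where "place_dvd v D \<longleftrightarrow> (case v of Finite_Place P \<Rightarrow> P dvd D | Infinite_Place \<Rightarrow> False)"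


section \<open>Drinfeld modules of rank 2\<close>

text \<open>
  Endomorphisms of the additive group over the fraction field are represented by polynomials,
  multiplied by composition.  The \<open>q\<close>-linear ones are the combinations of the monomials of
  degree \<open>q ^ i\<close>.
\<close>

definition q_linear :: "'a :: finite_field poly fract poly \<Rightarrow> bool"
  where "q_linear P \<longleftrightarrow> (\<forall>n. coeff P n \<noteq> 0 \<longrightarrow> (\<exists>i. n = CARD('a) ^ i))"

definition algebra_hom_to_End_Ga ::
    "('a :: finite_field poly \<Rightarrow> 'a poly fract poly) \<Rightarrow> bool"
  where "algebra_hom_to_End_Ga \<phi> \<longleftrightarrow>
    (\<forall>a. q_linear (\<phi> a)) \<and>
    (\<forall>a b. \<phi> (a + b) = \<phi> a + \<phi> b) \<and>
    (\<forall>a b. \<phi> (a * b) = pcompose (\<phi> a) (\<phi> b)) \<and>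
    (\<forall>c. \<phi> [:c:] = monom (to_fract [:c:]) 1)"

definition drinfeld_module_rank2 ::
    "('a :: finite_field poly \<Rightarrow> 'a poly fract poly) \<Rightarrow> 'a poly \<Rightarrow> 'a poly \<Rightarrow> bool"
  where "drinfeld_module_rank2 \<phi> g \<Delta> \<longleftrightarrow>
    algebra_hom_to_End_Ga \<phi> \<and> \<Delta> \<noteq> 0 \<and>
    \<phi> polyT = monom (to_fract polyT) 1 + monom (to_fract g) (CARD('a))
              + monom (to_fract \<Delta>) (CARD('a) ^ 2)"

definition torsion_point ::
    "('a :: finite_field poly \<Rightarrow> 'a poly fract poly) \<Rightarrow> 'a poly fract \<Rightarrow> bool"
  where "torsion_point \<phi> x \<longleftrightarrow> (\<exists>a. a \<noteq> 0 \<and> poly (\<phi> a) x = 0)"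


section \<open>Zsigmondy sets\<close>

text \<open>
  The numerator in lowest terms is determined only up to a unit, which does not affect its
  prime divisors.
\<close>

definition numerator :: "'a :: field poly fract \<Rightarrow> 'a poly"
  where "numerator y = (SOME A. \<exists>B. B \<noteq> 0 \<and> coprime A B \<and> y = to_fract A / to_fract B)"

definition primitive_divisor :: "(nat \<Rightarrow> 'a :: field poly) \<Rightarrow> nat \<Rightarrow> 'a poly \<Rightarrow> bool"
  where "primitive_divisor A n P \<longleftrightarrow> prime_elem P \<and> P dvd A n \<and> (\<forall>i<n. \<not> P dvd A i)"

definition zsigmondy_set ::
    "('a :: finite_field poly \<Rightarrow> 'a poly fract poly) \<Rightarrow> 'a poly fract \<Rightarrow> nat set"
  where "zsigmondy_set \<phi> x =
    {n. n \<ge> 1 \<and> (\<nexists>P. primitive_divisor (\<lambda>n. numerator (poly (\<phi> (polyT ^ n)) x)) n P)}"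


section \<open>Existence\<close>

lemma numerator_exists:
  fixes y :: "'a :: field poly fract"
  shows "\<exists>B. B \<noteq> 0 \<and> coprime (numerator y) B \<and> y = to_fract (numerator y) / to_fract B"
proof -
  have *: "\<exists>A' B'. B' \<noteq> 0 \<and> coprime A' B' \<and> to_fract A / to_fract B = to_fract A' / to_fract B'"
    if "B \<noteq> 0" for A B :: "'a poly"
    using that
  proof (induction "degree B" arbitrary: A B rule: less_induct)
    case less
    show ?case
    proof (cases "coprime A B")
      case False
      then obtain c where c: "c dvd A" "c dvd B" "\<not> is_unit c"
        by (auto simp: coprime_def)
      then obtain A' B' where AB: "A = c * A'" "B = c * B'"
        by (auto elim!: dvdE)
      with less.prems have nz: "c \<noteq> 0" "B' \<noteq> 0" by auto
      have "degree c > 0" using c(3) nz is_unit_iff_degree by blast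
      then have "degree B' < degree B"
        unfolding AB(2) using nz by (simp add: degree_mult_eq)
      from less.hyps[OF this nz(2), of A'] show ?thesis
        using nz by (simp add: AB)
    qed (use less.prems in blast)
  qed
  obtain a b where "y = Fract a b" "b \<noteq> 0" by (cases y)
  then have "y = to_fract a / to_fract b" by (simp add: to_fract_def)
  with *[OF \<open>b \<noteq> 0\<close>, of a] have "\<exists>A B. B \<noteq> 0 \<and> coprime A B \<and> y = to_fract A / to_fract B"
    by simp
  from someI_ex[OF this] show ?thesis
    unfolding numerator_def .
qed

lemma card_gt_1: "CARD('a :: finite_field) > 1"
  using card_mono[of "UNIV :: 'a set" "{0, 1}"] by simp

lemma finite_field_power_card: "x ^ CARD('a) = (x :: 'a :: finite_field)"
  using finite_field_power_card_eq_same[of x] by simp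

lemma of_nat_card_choose_eq_0:
  assumes "0 < k" "k < CARD('a)"
  shows "of_nat (CARD('a) choose k) = (0 :: 'a :: finite_field)"
proof -
  let ?q = "CARD('a)"
  define R :: "'a poly" where "R = [:1, 1:] ^ ?q - monom 1 ?q - 1"
  have lin: "[:1, 1:] = monom (1 :: 'a) 1 + 1"
    by (simp add: monom_Suc monom_0 one_pCons)
  have c: "coeff ([:1, 1:] ^ ?q :: 'a poly) i = of_nat (?q choose i)" for i
  proof -
    have "([:1, 1:] :: 'a poly) ^ ?q = (\<Sum>k\<le>?q. monom (of_nat (?q choose k)) k)"
      unfolding lin binomial_ring
      by (rule sum.cong) (simp_all add: monom_power of_nat_poly smult_monom)
    then show ?thesis
      by (simp add: coeff_sum if_distrib sum.delta binomial_eq_0 cong: if_cong)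
  qed
  have cR: "coeff R i = of_nat (?q choose i) - (if i = ?q then 1 else 0) - (if i = 0 then 1 else 0)"
    for i by (auto simp: R_def c)
  have "R = 0"
  proof (rule ccontr)
    assume "R \<noteq> 0"
    have "coeff R i = 0" if "i \<ge> ?q" for i
      using that by (cases "i = ?q") (auto simp: cR binomial_eq_0)
    then have "degree R < ?q"
      using \<open>R \<noteq> 0\<close> by (metis leading_coeff_0_iff not_less)
    moreover have "poly R x = 0" for x
      by (simp add: R_def poly_monom finite_field_power_card)
    then have "card {x. poly R x = 0} = ?q" by simp
    ultimately show False
      using card_poly_roots_bound[OF \<open>R \<noteq> 0\<close>] by simp
  qed
  then show ?thesis using cR[of k] assms by simp
qed

lemma card_power_add:
  fixes u v :: "'a :: finite_field poly fract poly"
  shows "(u + v) ^ CARD('a) = u ^ CARD('a) + v ^ CARD('a)"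
proof -
  let ?q = "CARD('a)"
  have z: "of_nat (?q choose k) = (0 :: 'a poly fract poly)" if "0 < k" "k < ?q" for k
  proof -
    have "of_nat (?q choose k) = ([:to_fract [:of_nat (?q choose k) :: 'a:]:])"
      by (simp add: of_nat_poly to_fract_def of_nat_fract)
    then show ?thesis using of_nat_card_choose_eq_0[OF that] by simp
  qed
  have "(u + v) ^ ?q = (\<Sum>k\<le>?q. of_nat (?q choose k) * u ^ k * v ^ (?q - k))"
    by (rule binomial_ring)
  also have "\<dots> = (\<Sum>k\<in>{0, ?q}. of_nat (?q choose k) * u ^ k * v ^ (?q - k))"
    by (rule sum.mono_neutral_right) (use z in auto)
  also have "\<dots> = u ^ ?q + v ^ ?q"
    using card_gt_1[where 'a = 'a] by (simp add: add.commute)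
  finally show ?thesis .
qed

lemma card_power_sum:
  fixes f :: "'b \<Rightarrow> 'a :: finite_field poly fract poly"
  shows "sum f A ^ CARD('a) = (\<Sum>i\<in>A. f i ^ CARD('a))"
  by (induction A rule: infinite_finite_induct)
     (use card_gt_1[where 'a = 'a] in \<open>auto simp: card_power_add\<close>)

lemma q_linear_power:
  fixes U :: "'a :: finite_field poly fract poly"
  assumes "q_linear U"
  shows "q_linear (U ^ CARD('a))"
  unfolding q_linear_def
proof (intro allI impI)
  let ?q = "CARD('a)"
  fix m assume m: "coeff (U ^ ?q) m \<noteq> 0"
  have "U ^ ?q = (\<Sum>n\<le>degree U. monom (coeff U n) n) ^ ?q"
    by (simp only: poly_as_sum_of_monoms)
  also have "\<dots> = (\<Sum>n\<le>degree U. monom (coeff U n ^ ?q) (n * ?q))"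
    by (simp add: card_power_sum monom_power)
  finally have "coeff (U ^ ?q) m = (\<Sum>n\<le>degree U. coeff (monom (coeff U n ^ ?q) (n * ?q)) m)"
    by (simp add: coeff_sum)
  with m obtain n where "coeff (monom (coeff U n ^ ?q) (n * ?q)) m \<noteq> 0"
    by (metis (no_types, lifting) sum.neutral)
  then have n: "m = n * ?q" "coeff U n \<noteq> 0"
    using card_gt_1[where 'a = 'a] by (auto split: if_splits)
  with assms obtain i where "n = ?q ^ i" by (auto simp: q_linear_def)
  with n show "\<exists>i. m = ?q ^ i" by (metis power_Suc2)
qed

lemma q_linear_0: "q_linear 0"
  by (simp add: q_linear_def)

lemma q_linear_add: "q_linear U \<Longrightarrow> q_linear V \<Longrightarrow> q_linear (U + V)"
  unfolding q_linear_def by (metis add.right_neutral coeff_add)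

lemma q_linear_smult: "q_linear U \<Longrightarrow> q_linear (smult c U)"
  by (simp add: q_linear_def)

lemma q_linear_monom_1: "q_linear (monom c 1)"
  unfolding q_linear_def by (metis coeff_monom power_0)

lemma pcompose_monom: "pcompose (monom c n) U = smult c (U ^ n)"
  for U :: "'b :: comm_ring_1 poly"
  by (induction n) (simp_all add: monom_0 monom_Suc pcompose_pCons)

lemma drinfeld_module_rank2_exists:
  fixes g \<Delta> :: "'a :: finite_field poly"
  assumes "\<Delta> \<noteq> 0"
  shows "\<exists>\<phi>. drinfeld_module_rank2 \<phi> g \<Delta>"
proof -
  let ?q = "CARD('a)"
  define k :: "'a \<Rightarrow> 'a poly fract" where "k c = to_fract [:c:]" for c
  have k_simps: "k 0 = 0" "k 1 = 1" "k (c + d) = k c + k d" "k (c * d) = k c * k d" for c d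
    using to_fract_add[of "[:c:]" "[:d:]"] to_fract_mult[of "[:c:]" "[:d:]"]
    by (simp_all add: k_def mult.commute flip: one_pCons)
  have k_pow: "k c ^ n = k (c ^ n)" for c n
    by (induction n) (simp_all add: k_simps)
  define F where "F = monom (to_fract polyT) 1 + monom (to_fract g) ?q + monom (to_fract \<Delta>) (?q ^ 2)"
  have F: "pcompose F U = smult (to_fract polyT) U + smult (to_fract g) (U ^ ?q)
             + smult (to_fract \<Delta>) ((U ^ ?q) ^ ?q)" for U
    by (simp add: F_def pcompose_add pcompose_monom power2_eq_square flip: power_mult)
  have F_add: "pcompose F (U + V) = pcompose F U + pcompose F V" for U V
    by (simp add: F card_power_add smult_add_right)
  have F_k: "pcompose F (monom (k c) 1) = smult (k c) F" for c
  proof -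
    have "k c ^ ?q = k c"
      by (simp add: k_pow finite_field_power_card)
    then show ?thesis
      unfolding F
      by (simp add: monom_power power2_eq_square smult_monom F_def smult_add_right mult.commute)
  qed
  have F_lin: "q_linear U \<Longrightarrow> q_linear (pcompose F U)" for U
    unfolding F by (intro q_linear_add q_linear_smult q_linear_power)
  have mk: "pcompose (monom (k c) 1) U = smult (k c) U" for c U
    by (simp add: pcompose_monom)
  define \<phi> where "\<phi> a = fold_coeffs (\<lambda>c P. monom (k c) 1 + pcompose P F) a 0" for a
  have \<phi>_0: "\<phi> 0 = 0"
    by (simp add: \<phi>_def)
  have \<phi>_pCons: "\<phi> (pCons c a) = monom (k c) 1 + pcompose (\<phi> a) F" for c a
    by (cases "c = 0 \<and> a = 0") (auto simp: \<phi>_def k_simps)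
  have \<phi>_add: "\<phi> (a + b) = \<phi> a + \<phi> b" for a b
    by (induction a b rule: poly_induct2)
       (simp_all add: \<phi>_0 \<phi>_pCons k_simps pcompose_add add_monom [symmetric])
  have \<phi>_smult: "\<phi> (smult c a) = smult (k c) (\<phi> a)" for c a
    by (induction a)
       (simp_all add: \<phi>_0 \<phi>_pCons k_simps pcompose_smult smult_monom smult_add_right)
  have comm: "pcompose (\<phi> b) F = pcompose F (\<phi> b)" for b
  proof (induction b)
    case 0
    show ?case by (simp add: \<phi>_0 F power_0_left)
  next
    case (pCons c b)
    then show ?case
      by (simp only: \<phi>_pCons pcompose_add F_add F_k mk) (metis pcompose_assoc)
  qed
  have \<phi>_mult: "\<phi> (a * b) = pcompose (\<phi> a) (\<phi> b)" for a b
  proof (induction a)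
    case 0
    show ?case by (simp add: \<phi>_0)
  next
    case (pCons c a)
    have "\<phi> (pCons c a * b) = smult (k c) (\<phi> b) + pcompose (pcompose (\<phi> a) (\<phi> b)) F"
      by (simp add: \<phi>_add \<phi>_smult \<phi>_pCons pCons.IH k_simps)
    also have "\<dots> = pcompose (\<phi> (pCons c a)) (\<phi> b)"
      by (simp only: \<phi>_pCons pcompose_add mk) (metis pcompose_assoc comm)
    finally show ?case .
  qed
  have \<phi>_lin: "q_linear (\<phi> a)" for a
    by (induction a)
       (auto simp only: \<phi>_0 \<phi>_pCons comm intro!: q_linear_0 q_linear_add q_linear_monom_1 F_lin)
  have \<phi>_const: "\<phi> [:c:] = monom (k c) 1" for c
    by (simp add: \<phi>_pCons \<phi>_0)
  have "\<phi> polyT = F"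
    by (simp only: \<phi>_pCons \<phi>_0 k_simps) (simp add: pcompose_monom)
  then have "drinfeld_module_rank2 \<phi> g \<Delta>"
    using \<phi>_lin \<phi>_add \<phi>_mult \<phi>_const assms
    by (simp add: drinfeld_module_rank2_def algebra_hom_to_End_Ga_def F_def k_def)
  then show ?thesis by blast
qed

end

theory Submission
  imports Defs
begin

text \<open>
  The points \<open>x\<^sub>n = \<phi>\<^bsub>T^n\<^esub>(x)\<close> are polynomials and \<open>x\<^sub>n\<close> divides \<open>x\<^sub>n\<^sub>+\<^sub>1\<close>, say
  \<open>x\<^sub>n\<^sub>+\<^sub>1 = x\<^sub>n u\<close> with \<open>u = T + g x\<^sub>n^(q-1) + \<Delta> x\<^sub>n^(q\<^sup>2-1)\<close>.  A prime dividing both \<open>u\<close> and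
  \<open>x\<^sub>n\<close> divides \<open>T\<close>, and for \<open>n \<ge> 1\<close> the square of \<open>T\<close> cannot divide \<open>u\<close> when \<open>T\<close> divides \<open>x\<^sub>n\<close>,
  since then already \<open>T\<^sup>2\<close> divides \<open>x\<^sub>n\<close>.  Hence \<open>x\<^sub>n\<^sub>+\<^sub>1\<close> has a primitive divisor as soon as
  \<open>deg u \<ge> 2\<close>, which holds as soon as the term \<open>\<Delta> x\<^sub>n^(q\<^sup>2)\<close> dominates and \<open>x\<^sub>n\<close> is not constant;
  these conditions persist along the orbit.

  They hold after at most three steps.  Otherwise \<open>x\<^sub>1\<close> and \<open>x\<^sub>2\<close> both have the unique degree in
  which the terms of \<open>g\<close> and \<open>\<Delta>\<close> can cancel, so that some \<open>y = x\<^sub>2 - c x\<^sub>1\<close> with \<open>c\<close> constant has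
  smaller degree.  It is nonzero because \<open>x\<close> is not torsion, and \<open>\<phi>\<^sub>T(y) = x\<^sub>3 - c x\<^sub>2\<close> has large
  degree, so one of \<open>x\<^sub>2\<close>, \<open>x\<^sub>3\<close> has.  In fact every element of the Zsigmondy set is at most 3.
\<close>

section \<open>Prime divisors, numerators and leading terms over a field\<close>

lemma prime_divisor_exists_poly:
  fixes u :: "'a :: field poly"
  assumes "degree u > 0"
  obtains P where "prime_elem P" "P dvd u"
proof -
  have "\<exists>P. prime_elem P \<and> P dvd u"
    using assms
  proof (induction "degree u" arbitrary: u rule: less_induct)
    case less
    have u: "u \<noteq> 0" using less.prems by auto
    have u': "\<not> is_unit u"
      using less.prems is_unit_iff_degree[OF u] by linarith
    show ?case
    proof (cases "irreducible u")
      case True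
      from field_poly_irreducible_imp_prime[OF this] show ?thesis using dvd_refl by blast
    next
      case False
      with u u' obtain a b where ab: "u = a * b" "\<not> is_unit a" "\<not> is_unit b"
        by (auto simp: irreducible_def)
      with u have nz: "a \<noteq> 0" "b \<noteq> 0" by auto
      then have "degree a > 0" "degree b > 0"
        using ab is_unit_iff_degree[of a] is_unit_iff_degree[of b] by blast+
      moreover from this have "degree a < degree u"
        unfolding ab(1) using nz by (simp add: degree_mult_eq)
      ultimately show ?thesis
        using less.hyps[of a] dvd_mult2[of _ a b] unfolding ab(1) by blast
    qed
  qed
  then show ?thesis using that by blast
qed

lemma polyT_dvd_of_prime_dvd:
  fixes P u :: "'a :: field poly"
  assumes "prime_elem P" "P dvd polyT" "P dvd u"
  shows "polyT dvd u"
proof -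
  have "irreducible (polyT :: 'a poly)"
    by (rule irreducible_linear_field_poly) simp
  with assms show ?thesis
    by (metis dvd_trans irreducibleD' prime_elem_def)
qed

text \<open>\<open>numerator\<close> is a choice, fixed only up to a unit: the denominator that
  comes with it divides it and is coprime to it, hence is a unit.\<close>

lemma dvd_numerator_to_fract_iff: "P dvd numerator (to_fract y) \<longleftrightarrow> P dvd y"
proof -
  obtain B where B: "B \<noteq> 0" "coprime (numerator (to_fract y)) B"
    "to_fract y = to_fract (numerator (to_fract y)) / to_fract B"
    using numerator_exists by blast
  then have "to_fract (y * B) = to_fract (numerator (to_fract y))"
    by (simp add: field_simps)
  then have eq: "y * B = numerator (to_fract y)"
    by (simp only: to_fract_eq_iff)
  with B(2) have "is_unit B"
    by (metis coprime_absorb_right coprime_commute dvd_triv_right)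
  then show ?thesis
    by (metis eq dvd_mult_unit_iff)
qed

lemma exists_degree_diff_smult_less:
  fixes a b :: "'a :: field poly"
  assumes "degree a = degree b" "degree b > 0"
  obtains c where "degree (a - smult c b) < degree b"
proof
  let ?c = "lead_coeff a / lead_coeff b"
  have "b \<noteq> 0" using assms by auto
  show "degree (a - smult ?c b) < degree b"
  proof (rule degree_lessI)
    show "\<forall>k\<ge>degree b. coeff (a - smult ?c b) k = 0"
    proof (intro allI impI)
      fix k assume "k \<ge> degree b"
      then show "coeff (a - smult ?c b) k = 0"
        using assms \<open>b \<noteq> 0\<close> by (cases "k = degree b") (auto simp: coeff_eq_0)
    qed
  qed (use assms in auto)
qed

section \<open>The action of \<open>T\<close> on polynomials\<close>

definition phi_T :: "'a :: finite_field poly \<Rightarrow> 'a poly \<Rightarrow> 'a poly \<Rightarrow> 'a poly"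
  where "phi_T g \<Delta> y = polyT * y + g * y ^ CARD('a) + \<Delta> * y ^ (CARD('a)\<^sup>2)"

text \<open>The quotient of \<open>phi_T g \<Delta> y\<close> by \<open>y\<close>, with one more
  \<open>y\<close> pulled out so that it is visibly congruent to T modulo \<open>y\<close>.\<close>

definition phi_T_cofactor :: "'a :: finite_field poly \<Rightarrow> 'a poly \<Rightarrow> 'a poly \<Rightarrow> 'a poly"
  where "phi_T_cofactor g \<Delta> y =
    polyT + y * (g * y ^ (CARD('a) - 2) + \<Delta> * y ^ ((CARD('a))\<^sup>2 - 2))"

lemma card_ge_2: "CARD('a :: finite_field) \<ge> 2"
  using card_gt_1[where 'a = 'a] by simp

lemma phi_T_eq_mult:
  fixes g \<Delta> y :: "'a :: finite_field poly"
  shows "phi_T g \<Delta> y = y * phi_T_cofactor g \<Delta> y"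
proof -
  let ?q = "CARD('a)"
  have q: "?q \<ge> 2" by (rule card_ge_2)
  then have q2: "?q\<^sup>2 \<ge> 2"
    using le_square[of ?q] unfolding power2_eq_square by (rule order.trans)
  have "y ^ ?q = y * (y * y ^ (?q - 2))" "y ^ ?q\<^sup>2 = y * (y * y ^ (?q\<^sup>2 - 2))"
    using q q2 by (simp_all add: power_eq_if numeral_2_eq_2 flip: power_Suc)
  then show ?thesis
    by (simp only: phi_T_def phi_T_cofactor_def) (simp only: algebra_simps)
qed

text \<open>Values at 0 lie in the base field, where q-th powers are the identity. So
  \<open>phi_T\<close> multiplies them by g(0) + \<Delta>(0), which is nonzero by
  coprimality.\<close>

lemma polyT_dvd_phi_T_iff:
  fixes g \<Delta> y :: "'a :: finite_field poly"
  assumes "coprime (polyT + g + \<Delta>) (polyT * \<Delta>)"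
  shows "polyT dvd phi_T g \<Delta> y \<longleftrightarrow> polyT dvd y"
proof -
  have dvd: "polyT dvd p \<longleftrightarrow> poly p 0 = 0" for p :: "'a poly"
    using poly_eq_0_iff_dvd[of p 0] by simp
  have "\<not> polyT dvd polyT + g + \<Delta>"
  proof
    assume "polyT dvd polyT + g + \<Delta>"
    moreover have "polyT dvd polyT * \<Delta>" by (rule dvd_triv_left)
    ultimately have "is_unit (polyT :: 'a poly)"
      using assms coprime_common_divisor by blast
    then show False by (simp add: is_unit_iff_degree)
  qed
  then have "poly g 0 + poly \<Delta> 0 \<noteq> 0" by (simp add: dvd)
  moreover have "poly y 0 ^ (CARD('a)\<^sup>2) = poly y 0"
    by (simp add: power2_eq_square power_mult finite_field_power_card)
  then have "poly (phi_T g \<Delta> y) 0 = (poly g 0 + poly \<Delta> 0) * poly y 0"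
    by (simp add: phi_T_def finite_field_power_card algebra_simps)
  ultimately show ?thesis by (simp add: dvd)
qed

lemma polyT_square_dvd_phi_T:
  fixes g \<Delta> y :: "'a :: finite_field poly"
  assumes "polyT dvd y"
  shows "polyT ^ 2 dvd phi_T g \<Delta> y"
proof -
  have "polyT dvd phi_T_cofactor g \<Delta> y"
    using assms by (simp add: phi_T_cofactor_def)
  with assms show ?thesis
    unfolding phi_T_eq_mult power2_eq_square by (rule mult_dvd_mono)
qed

lemma exists_new_prime_divisor:
  fixes g \<Delta> y :: "'a :: finite_field poly"
  assumes deg: "degree (phi_T_cofactor g \<Delta> y) \<ge> 2"
    and T: "polyT dvd y \<Longrightarrow> polyT ^ 2 dvd y"
  obtains P where "prime_elem P" "P dvd phi_T g \<Delta> y" "\<not> P dvd y"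
proof -
  let ?u = "phi_T_cofactor g \<Delta> y"
  have "\<exists>P. prime_elem P \<and> P dvd ?u \<and> \<not> P dvd y"
  proof (rule ccontr)
    assume neg: "\<not> ?thesis"
    \<comment> \<open>Used for \<open>?u\<close> and then for the quotient of \<open>?u\<close> by
      T, still nonconstant as \<open>?u\<close> has degree at least 2; together they make T^2 divide
      \<open>?u\<close>.\<close>
    have T_dvd: "polyT dvd w \<and> polyT dvd y" if w: "degree w > 0" "w dvd ?u" for w
    proof -
      obtain P where P: "prime_elem P" "P dvd w"
        using prime_divisor_exists_poly w(1) by blast
      with w neg have Py: "P dvd y" and Pu: "P dvd ?u" by (auto dest: dvd_trans)
      then have "P dvd polyT"
        unfolding phi_T_cofactor_def by (metis dvd_add_left_iff dvd_mult2)
      with P Py show ?thesis using polyT_dvd_of_prime_dvd by blast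
    qed
    have Tu: "polyT dvd ?u" "polyT dvd y" using T_dvd[of ?u] deg by auto
    then obtain w where w: "?u = polyT * w" by (elim dvdE)
    with deg have "w \<noteq> 0" by auto
    have "degree ?u = 1 + degree w"
      unfolding w using \<open>w \<noteq> 0\<close> by (subst degree_mult_eq) auto
    with deg have "degree w > 0" by simp
    moreover have "w dvd ?u" unfolding w by (rule dvd_triv_right)
    ultimately have "polyT dvd w" using T_dvd by blast
    then have "polyT ^ 2 dvd ?u" unfolding w by (simp only: power2_eq_square mult_dvd_mono dvd_refl)
    moreover have "polyT ^ 2 dvd y" using T Tu by blast
    ultimately have "polyT ^ 2 dvd (polyT :: 'a poly)"
      unfolding phi_T_cofactor_def by (metis dvd_add_left_iff dvd_mult2)
    then have "degree (polyT ^ 2 :: 'a poly) \<le> degree (polyT :: 'a poly)"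
      by (rule dvd_imp_degree_le) simp
    then show False by (simp add: degree_power_eq)
  qed
  then show ?thesis using that by (auto simp: phi_T_eq_mult)
qed

section \<open>Growth of degrees\<close>

text \<open>For nonzero g and \<Delta>, the inequality says that \<Delta> y^(q^2) has larger degree
  than g y^q, with q deg y cancelled; positive degree makes it beat T y as well.\<close>

definition escaped :: "'a :: finite_field poly \<Rightarrow> 'a poly \<Rightarrow> 'a poly \<Rightarrow> bool"
  where "escaped g \<Delta> y \<longleftrightarrow>
    degree y > 0 \<and> degree g < CARD('a) * (CARD('a) - 1) * degree y + degree \<Delta>"

lemma escaped_mono:
  fixes y :: "'a :: finite_field poly"
  assumes "escaped g \<Delta> y" "degree y \<le> degree z"
  shows "escaped g \<Delta> z"
proof -
  have "CARD('a) * (CARD('a) - 1) * degree y \<le> CARD('a) * (CARD('a) - 1) * degree z"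
    using assms(2) by (rule mult_le_mono2)
  with assms show ?thesis unfolding escaped_def by linarith
qed

lemma card_square_eq: "(CARD('a :: finite_field))\<^sup>2 = CARD('a) * (CARD('a) - 1) + CARD('a)"
  using card_ge_2[where 'a = 'a] by (cases "CARD('a)") (auto simp: power2_eq_square)

lemma card_mult_pred_ge_2: "CARD('a :: finite_field) * (CARD('a) - 1) \<ge> 2"
  using mult_le_mono[OF card_ge_2[where 'a = 'a], of 1 "CARD('a) - 1"] card_ge_2[where 'a = 'a]
  by simp

lemma degree_phi_T_terms:
  fixes g \<Delta> y :: "'a :: finite_field poly"
  assumes "y \<noteq> 0"
  shows "degree (polyT * y) = 1 + degree y"
    and "g \<noteq> 0 \<Longrightarrow> degree (g * y ^ CARD('a)) = degree g + CARD('a) * degree y"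
    and "\<Delta> \<noteq> 0 \<Longrightarrow> degree (\<Delta> * y ^ (CARD('a)\<^sup>2)) =
      degree \<Delta> + CARD('a) * (CARD('a) - 1) * degree y + CARD('a) * degree y"
proof -
  show "degree (polyT * y) = 1 + degree y"
    by (subst degree_mult_eq) (use assms in auto)
  show "degree (g * y ^ CARD('a)) = degree g + CARD('a) * degree y" if "g \<noteq> 0"
    by (subst degree_mult_eq) (use assms that in \<open>auto simp: degree_power_eq\<close>)
  have "degree (\<Delta> * y ^ (CARD('a)\<^sup>2)) = degree \<Delta> + (CARD('a))\<^sup>2 * degree y" if "\<Delta> \<noteq> 0"
    by (subst degree_mult_eq) (use assms that in \<open>auto simp: degree_power_eq\<close>)
  then show "degree (\<Delta> * y ^ (CARD('a)\<^sup>2)) =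
      degree \<Delta> + CARD('a) * (CARD('a) - 1) * degree y + CARD('a) * degree y" if "\<Delta> \<noteq> 0"
    using that by (simp only: card_square_eq distrib_right add.assoc simp_thms)
qed

lemma degree_phi_T_escaped:
  fixes g \<Delta> y :: "'a :: finite_field poly"
  assumes "escaped g \<Delta> y" "\<Delta> \<noteq> 0"
  shows "degree (phi_T g \<Delta> y) \<ge> 4 * degree y"
proof -
  let ?q = "CARD('a)"
  define d where "d = degree y"
  have d: "d > 0" "degree g < ?q * (?q - 1) * d + degree \<Delta>" "y \<noteq> 0"
    using assms by (auto simp: escaped_def d_def)
  have r: "?q * (?q - 1) * d \<ge> 2 * d" "?q * d \<ge> 2 * d"
    using mult_le_mono1[OF card_mult_pred_ge_2[where 'a = 'a]]
      mult_le_mono1[OF card_ge_2[where 'a = 'a]] by blast+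
  let ?D = "degree (\<Delta> * y ^ (?q\<^sup>2))"
  note D = degree_phi_T_terms(3)[OF \<open>y \<noteq> 0\<close> \<open>\<Delta> \<noteq> 0\<close>, folded d_def]
  have 1: "degree (polyT * y) < ?D"
    unfolding D degree_phi_T_terms(1)[OF \<open>y \<noteq> 0\<close>] d_def[symmetric] using r d by linarith
  have 2: "degree (g * y ^ ?q) < ?D"
  proof (cases "g = 0")
    case True
    then have "degree (g * y ^ ?q) = 0" by simp
    then show ?thesis unfolding D using r d by linarith
  next
    case False
    show ?thesis
      unfolding D degree_phi_T_terms(2)[OF \<open>y \<noteq> 0\<close> False] d_def[symmetric] using d by linarith
  qed
  from 1 2 have "degree (phi_T g \<Delta> y) = ?D"
    unfolding phi_T_def by (intro degree_add_eq_right degree_add_less)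
  then show ?thesis using D r unfolding d_def by linarith
qed

lemma escaped_phi_T:
  assumes "escaped g \<Delta> y" "\<Delta> \<noteq> 0"
  shows "escaped g \<Delta> (phi_T g \<Delta> y)"
  using escaped_mono[OF assms(1), of "phi_T g \<Delta> y"] degree_phi_T_escaped[OF assms] by simp

text \<open>Below the threshold g y^q dominates, so the image has degree at least deg g; the factor
  q(q-1) \<ge> 2 then lifts it over the threshold. The bound deg g \<ge> 2 is what beats T y when
  \<open>y\<close> is constant.\<close>

lemma escaped_phi_T_of_small_degree:
  fixes g \<Delta> y :: "'a :: finite_field poly"
  assumes "\<Delta> \<noteq> 0" "y \<noteq> 0" "degree g \<ge> 2"
    and "CARD('a) * (CARD('a) - 1) * degree y + degree \<Delta> < degree g"
  shows "escaped g \<Delta> (phi_T g \<Delta> y)"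
proof -
  let ?q = "CARD('a)"
  define d where "d = degree y"
  have r: "?q * d \<ge> 2 * d"
    using mult_le_mono1[OF card_ge_2[where 'a = 'a]] by blast
  have "g \<noteq> 0" using assms(3) by auto
  let ?D = "degree (g * y ^ ?q)"
  note D = degree_phi_T_terms(2)[OF \<open>y \<noteq> 0\<close> \<open>g \<noteq> 0\<close>, folded d_def]
  have 1: "degree (polyT * y) < ?D"
    unfolding D degree_phi_T_terms(1)[OF \<open>y \<noteq> 0\<close>] d_def[symmetric] using r assms(3) by linarith
  have 2: "degree (\<Delta> * y ^ (?q\<^sup>2)) < ?D"
    unfolding D degree_phi_T_terms(3)[OF \<open>y \<noteq> 0\<close> \<open>\<Delta> \<noteq> 0\<close>] d_def[symmetric]
    using assms(4)[folded d_def] by linarith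
  have "degree (phi_T g \<Delta> y) = ?D"
    unfolding phi_T_def using 1 2 by (metis degree_add_eq_left degree_add_eq_right)
  then have "degree (phi_T g \<Delta> y) \<ge> degree g" using D by simp
  moreover from this have "?q * (?q - 1) * degree (phi_T g \<Delta> y) \<ge> 2 * degree g"
    using card_mult_pred_ge_2[where 'a = 'a] by (intro mult_le_mono)
  ultimately show ?thesis using assms(3) by (simp add: escaped_def)
qed

section \<open>Orbits of non-torsion points\<close>

lemma escaped_within_three_steps:
  fixes g \<Delta> :: "'a :: finite_field poly" and X :: "nat \<Rightarrow> 'a poly"
  assumes \<Delta>: "\<Delta> \<noteq> 0"
    and X: "\<And>n. X (Suc n) = phi_T g \<Delta> (X n)"
    and lin: "\<And>n c. phi_T g \<Delta> (X (Suc n) - smult c (X n)) = X (Suc (Suc n)) - smult c (X (Suc n))"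
    and nontorsion: "\<And>n c. X (Suc n) \<noteq> smult c (X n)"
    and nz: "\<And>n. X n \<noteq> 0"
  shows "escaped g \<Delta> (X 3)"
proof (rule ccontr)
  let ?r = "CARD('a) * (CARD('a) - 1)"
  assume neg3: "\<not> escaped g \<Delta> (X 3)"
  have X3: "X 3 = phi_T g \<Delta> (X 2)" and X2: "X 2 = phi_T g \<Delta> (X 1)"
    using X[of 2] X[of 1] by (simp_all add: numeral_3_eq_3 numeral_2_eq_2)
  from neg3 have neg2: "\<not> escaped g \<Delta> (X 2)" using X3 escaped_phi_T \<Delta> by metis
  then have neg1: "\<not> escaped g \<Delta> (X 1)" using X2 escaped_phi_T \<Delta> by metis
  \<comment> \<open>Two constants would be proportional, contradicting \<open>nontorsion\<close>. A
    positive degree without escape then forces deg g \<ge> 2.\<close>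
  have "degree (X 1) > 0 \<or> degree (X 2) > 0"
  proof (rule ccontr)
    assume "\<not> ?thesis"
    then obtain a b where ab: "X 1 = [:a:]" "X 2 = [:b:]"
      by (metis degree_eq_zeroE neq0_conv)
    with nz[of 1] have "X 2 = smult (b / a) (X 1)" by simp
    with nontorsion[of 1] show False by (simp add: numeral_2_eq_2)
  qed
  then obtain d where d: "d > 0" "?r * d + degree \<Delta> \<le> degree g"
    using neg1 neg2 by (auto simp: escaped_def not_less)
  have "?r * d \<ge> 2"
    using mult_le_mono[OF card_mult_pred_ge_2[where 'a = 'a], of 1 d] d(1) by simp
  with d have g2: "degree g \<ge> 2" by simp
  \<comment> \<open>Below the threshold the next point would escape, above it this one has. A
    constant point never counts as escaped, so its upper bound is deg \<Delta> \<le> deg g.\<close>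
  have eq: "?r * degree (X i) + degree \<Delta> = degree g"
    if "\<not> escaped g \<Delta> (X i)" "\<not> escaped g \<Delta> (phi_T g \<Delta> (X i))" for i
  proof -
    have "\<not> ?r * degree (X i) + degree \<Delta> < degree g"
      using escaped_phi_T_of_small_degree[OF \<Delta> nz g2] that(2) by blast
    moreover have "?r * degree (X i) + degree \<Delta> \<le> degree g" if "degree (X i) > 0"
      using \<open>\<not> escaped g \<Delta> (X i)\<close> that by (simp add: escaped_def)
    moreover have "degree \<Delta> \<le> degree g" using d by simp
    ultimately show ?thesis by (cases "degree (X i) = 0") auto
  qed
  have e1: "?r * degree (X 1) + degree \<Delta> = degree g" using eq[of 1] neg1 neg2 X2 by simp
  have e2: "?r * degree (X 2) + degree \<Delta> = degree g" using eq[of 2] neg2 neg3 X3 by simp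
  have rpos: "?r > 0" using card_mult_pred_ge_2[where 'a = 'a] by linarith
  have "?r * degree (X 1) = ?r * degree (X 2)" using e1 e2 by linarith
  with rpos have deg: "degree (X 2) = degree (X 1)" by (metis mult_cancel1 neq0_conv)
  with \<open>degree (X 1) > 0 \<or> degree (X 2) > 0\<close> have "degree (X 1) > 0" by simp
  with deg obtain c where c: "degree (X 2 - smult c (X 1)) < degree (X 1)"
    by (rule exists_degree_diff_smult_less)
  let ?y = "X 2 - smult c (X 1)"
  have "?r * degree ?y < ?r * degree (X 1)" using c rpos by (metis mult_less_cancel1)
  then have "?r * degree ?y + degree \<Delta> < degree g" using e1 by linarith
  moreover have "?y \<noteq> 0" using nontorsion[of 1] by (simp add: numeral_2_eq_2)
  ultimately have esc: "escaped g \<Delta> (phi_T g \<Delta> ?y)"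
    using escaped_phi_T_of_small_degree[OF \<Delta> _ g2] by blast
  have "phi_T g \<Delta> ?y = X 3 - smult c (X 2)"
    using lin[of 1] by (simp add: numeral_3_eq_3 numeral_2_eq_2)
  \<comment> \<open>One of \<open>X 2\<close>, \<open>X 3\<close> has at least the degree of the
    escaped point \<open>phi_T g \<Delta> ?y\<close>, so it has escaped too.\<close>
  then have "degree (phi_T g \<Delta> ?y) \<le> max (degree (X 3)) (degree (X 2))"
    by (simp add: degree_diff_le_max degree_smult_le order.trans[OF degree_diff_le_max])
  then show False
    using escaped_mono[OF esc] neg2 neg3 by (metis max_def)
qed

text \<open>The index \<open>Suc k\<close> provides a predecessor: if T divides
  \<open>X (Suc k)\<close> it divides \<open>X k\<close>, so T^2 divides \<open>X (Suc k)\<close>. A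
  prime not dividing \<open>X (Suc k)\<close> divides no earlier point, as each divides the
  next.\<close>

lemma primitive_divisor_of_orbit:
  fixes g \<Delta> :: "'a :: finite_field poly" and X :: "nat \<Rightarrow> 'a poly"
  assumes \<Delta>: "\<Delta> \<noteq> 0"
    and cop: "coprime (polyT + g + \<Delta>) (polyT * \<Delta>)"
    and X: "\<And>n. X (Suc n) = phi_T g \<Delta> (X n)"
    and esc: "escaped g \<Delta> (X (Suc k))"
  shows "\<exists>P. primitive_divisor X (Suc (Suc k)) P"
proof -
  let ?y = "X (Suc k)"
  have y: "degree ?y > 0" "?y \<noteq> 0" using esc by (auto simp: escaped_def)
  have "4 * degree ?y \<le> degree (?y * phi_T_cofactor g \<Delta> ?y)"
    using degree_phi_T_escaped[OF esc \<Delta>] by (simp add: phi_T_eq_mult)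
  also have "\<dots> \<le> degree ?y + degree (phi_T_cofactor g \<Delta> ?y)"
    by (rule degree_mult_le)
  finally have "degree (phi_T_cofactor g \<Delta> ?y) \<ge> 2" using y by simp
  moreover have "polyT ^ 2 dvd ?y" if "polyT dvd ?y"
    using that polyT_dvd_phi_T_iff[OF cop] polyT_square_dvd_phi_T by (simp only: X)
  ultimately obtain P where P: "prime_elem P" "P dvd X (Suc (Suc k))" "\<not> P dvd ?y"
    using exists_new_prime_divisor[of g \<Delta> ?y] X by metis
  have "X i dvd ?y" if "i \<le> Suc k" for i
    using that by (induction rule: dec_induct) (auto simp: X phi_T_eq_mult intro: dvd_mult2)
  with P have "primitive_divisor X (Suc (Suc k)) P"
    unfolding primitive_divisor_def by (meson dvd_trans less_Suc_eq_le)
  then show ?thesis by blast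
qed

lemma zsigmondy_set_le_3:
  fixes \<phi> :: "'a :: finite_field poly \<Rightarrow> 'a poly fract poly"
  assumes \<phi>: "drinfeld_module_rank2 \<phi> g \<Delta>"
    and cop: "coprime (polyT + g + \<Delta>) (polyT * \<Delta>)"
    and nt: "\<not> torsion_point \<phi> (to_fract x)"
    and n: "n \<in> zsigmondy_set \<phi> (to_fract x)"
  shows "n \<le> 3"
proof (rule ccontr)
  assume "\<not> n \<le> 3"
  have \<Delta>: "\<Delta> \<noteq> 0" and add: "\<phi> (a + b) = \<phi> a + \<phi> b"
    and mult: "\<phi> (a * b) = pcompose (\<phi> a) (\<phi> b)"
    and const: "\<phi> [:c:] = monom (to_fract [:c:]) 1"
    and \<phi>T: "\<phi> polyT = monom (to_fract polyT) 1 + monom (to_fract g) (CARD('a))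
              + monom (to_fract \<Delta>) (CARD('a) ^ 2)" for a b c
    using \<phi> by (simp_all add: drinfeld_module_rank2_def algebra_hom_to_End_Ga_def)
  have to_fract_power: "to_fract (y ^ k) = to_fract y ^ k" for y :: "'a poly" and k
    by (induction k) simp_all
  define E where "E a = poly (\<phi> a) (to_fract x)" for a
  have E_T: "E (polyT * a) = to_fract (phi_T g \<Delta> y)" if "E a = to_fract y" for a y
    using that unfolding E_def mult
    by (simp only: poly_pcompose \<phi>T poly_add poly_monom phi_T_def to_fract_add to_fract_mult
        to_fract_power power_one_right)
  have E_lin: "E (a + [:c:] * b) = to_fract (y + smult c z)"
    if "E a = to_fract y" "E b = to_fract z" for a b c y z
  proof -
    have "smult c z = [:c:] * z" by simp
    then show ?thesis
      using that unfolding E_def mult add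
      by (simp only: poly_add poly_pcompose const poly_monom to_fract_add to_fract_mult power_one_right)
  qed
  define X where "X n = (phi_T g \<Delta> ^^ n) x" for n
  have X: "X (Suc n) = phi_T g \<Delta> (X n)" for n by (simp add: X_def)
  have EX: "E (polyT ^ n) = to_fract (X n)" for n
  proof (induction n)
    case 0
    show ?case using const[of 1] by (simp add: E_def X_def poly_monom flip: one_pCons)
  next
    case (Suc n)
    then show ?case using E_T X by simp
  qed
  have E_nz: "E a \<noteq> 0" if "a \<noteq> 0" for a
    using nt that by (auto simp: torsion_point_def E_def)
  have X_nz: "X n \<noteq> 0" for n
    using E_nz[of "polyT ^ n"] EX[of n] by auto
  have E_diff: "E (polyT ^ Suc n + [:- c:] * polyT ^ n) = to_fract (X (Suc n) - smult c (X n))" for n c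
    using E_lin[OF EX EX, of "Suc n" "- c" n] by simp
  \<comment> \<open>Differences of the form \<open>X (Suc n) - smult c (X n)\<close> are thus values
    of \<phi> at (T - c) T^n, so they cannot vanish at a non-torsion point.\<close>
  have factor: "polyT ^ Suc n + [:- c:] * polyT ^ n = [:- c, 1:] * polyT ^ n" for n and c :: 'a
  proof -
    have "[:- c, 1:] = polyT + [:- c:]" by simp
    then show ?thesis by (simp only: distrib_right power_Suc)
  qed
  have nontorsion: "X (Suc n) \<noteq> smult c (X n)" for n c
  proof
    assume "X (Suc n) = smult c (X n)"
    then have "E ([:- c, 1:] * polyT ^ n) = 0" using E_diff[of n c] by (simp only: factor) simp
    moreover have "[:- c, 1:] * polyT ^ n \<noteq> 0" unfolding mult_eq_0_iff by simp
    ultimately show False using E_nz by blast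
  qed
  have lin: "phi_T g \<Delta> (X (Suc n) - smult c (X n)) = X (Suc (Suc n)) - smult c (X (Suc n))" for n c
  proof -
    have "polyT * (polyT ^ Suc n + [:- c:] * polyT ^ n)
      = polyT ^ Suc (Suc n) + [:- c:] * polyT ^ Suc n"
      by (simp only: power_Suc distrib_left mult.left_commute)
    with E_T[OF E_diff, of n c] E_diff[of "Suc n" c]
    show ?thesis by (simp only: to_fract_eq_iff)
  qed
  have "escaped g \<Delta> (X (3 + k))" for k
  proof (induction k)
    case 0
    show ?case using escaped_within_three_steps[of \<Delta> X g, OF \<Delta> X lin nontorsion X_nz] by simp
  next
    case (Suc k)
    then show ?case using escaped_phi_T[OF _ \<Delta>] by (simp only: add_Suc_right X)
  qed
  moreover define k where "k = n - 2"
  \<comment> \<open>For n \<ge> 4 the predecessor n - 1 is at least 3, where escape is already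
    known.\<close>
  with \<open>\<not> n \<le> 3\<close> have k: "n = Suc (Suc k)" "Suc k = 3 + (k - 2)" by simp_all
  ultimately have "escaped g \<Delta> (X (Suc k))" by metis
  then obtain P where "primitive_divisor X n P"
    using primitive_divisor_of_orbit[of \<Delta> g X, OF \<Delta> cop X] k by blast
  then have "primitive_divisor (\<lambda>n. numerator (poly (\<phi> (polyT ^ n)) (to_fract x))) n P"
    using EX by (simp add: primitive_divisor_def E_def dvd_numerator_to_fract_iff)
  with n show False by (auto simp: zsigmondy_set_def)
qed

theorem theorem1p1:
  fixes \<phi> :: "'a :: finite_field poly \<Rightarrow> 'a poly fract poly"
    and g \<Delta> x :: "'a poly"
    and q N :: nat
    and S :: "'a poly place set"
  assumes "q = CARD('a)"
    and "drinfeld_module_rank2 \<phi> g \<Delta>"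
    and "N = Lcm (degree ` {P. irreducible P \<and> P dvd \<Delta>})"
    and "coprime (polyT + g + \<Delta>) (polyT * \<Delta>)"
    and "S = {v \<in> places. place_dvd v (polyT * \<Delta>)} \<union> {Infinite_Place}"
    and "\<not> torsion_point \<phi> (to_fract x)"
  shows "finite (zsigmondy_set \<phi> (to_fract x)) \<and>
    (zsigmondy_set \<phi> (to_fract x) \<noteq> {} \<longrightarrow>
      real (Max (zsigmondy_set \<phi> (to_fract x)))
        \<le> (6 * (real q ^ (2 * N) - 1) * real N * real (card S) + 4)
          + 1 / 2 * log (real q) (2 + 2 * real (degree g) + 2 * real (degree \<Delta>)))"
proof (intro conjI impI)
  let ?Z = "zsigmondy_set \<phi> (to_fract x)"
  have Z: "n \<le> 3" if "n \<in> ?Z" for n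
    using zsigmondy_set_le_3 assms that by blast
  then show fin: "finite ?Z" by (meson finite_nat_set_iff_bounded_le)
  assume "?Z \<noteq> {}"
  with fin Z have "Max ?Z \<le> 3" by simp
  \<comment> \<open>The constant 4 already exceeds 3, so it remains to see that the other two
    summands are nonnegative.\<close>
  then have "real (Max ?Z) \<le> 3" by simp
  moreover have q: "real q > 1" using card_gt_1[where 'a = 'a] assms(1) by simp
  then have "real q ^ (2 * N) \<ge> 1" by (intro one_le_power) simp
  then have "6 * (real q ^ (2 * N) - 1) * real N * real (card S) \<ge> 0" by simp
  moreover have "log (real q) (2 + 2 * real (degree g) + 2 * real (degree \<Delta>)) \<ge> 0"
    using q by (subst zero_le_log_cancel_iff) auto
  ultimately show "real (Max ?Z)
        \<le> (6 * (real q ^ (2 * N) - 1) * real N * real (card S) + 4)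
          + 1 / 2 * log (real q) (2 + 2 * real (degree g) + 2 * real (degree \<Delta>))"
    by linarith
qed

end
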